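(* Let $P:E\to B$ be a covering of small categories and let $b$ be an object of $B$. Then for every integer $n\ge 0$, the set $N_n(E)$ is in bijection with $\coprod_{x\in P^{-1}(b)} N_n(B)$.
   Context: A small category $C$ is connected if for any objects $x,y$ of $C$ there is a finite zig-zag of morphisms $x\to x_1\leftarrow x_2\to\cdots\leftarrow y$ in $C$. For an object $x$ of $C$, $S(x)$ denotes the set of morphisms of $C$ with source $x$, and $T(x)$ the set of morphisms of $C$ with target $x$. Let $E$ and $B$ be small categories with $B$ connected. A functor $P:E\to B$ is a covering if for every object $x$ of $E$ the restrictions $P:S(x)\to S(P(x))$ and $P:T(x)\to T(P(x))$ are bijections. For an object $b$ of $B$, the fiber is $P^{-1}(b)=\{x\in \mathrm{Ob}(E)\mid P(x)=b\}$. For a small category $C$ and $n\ge 0$, $N_n(C)$ is the set of chains $x_0\xrightarrow{f_1}x_1\xrightarrow{f_2}\cdots\xrightarrow{f_n}x_n$ of $n$ composable morphisms in $C$ (identities allowed); $N_0(C)=\mathrm{Ob}(C)$. *)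

theory Defs
  imports Main
begin

(* A small category is given by a set of objects and a set of morphisms inside arbitrary types;
   the operations are only meaningful on these sets. Comp C g f is the composite "g after f". *)

record ('o, 'm) cat =
  Ob :: "'o set"
  Mor :: "'m set"
  Source :: "'m \<Rightarrow> 'o"
  Target :: "'m \<Rightarrow> 'o"
  Ident :: "'o \<Rightarrow> 'm"
  Comp :: "'m \<Rightarrow> 'm \<Rightarrow> 'm"

definition Hom :: "('o, 'm) cat \<Rightarrow> 'o \<Rightarrow> 'o \<Rightarrow> 'm set" where
  "Hom C x y = {f \<in> Mor C. Source C f = x \<and> Target C f = y}"

locale small_category =
  fixes C :: "('o, 'm) cat"
  assumes source_in_Ob: "f \<in> Mor C \<Longrightarrow> Source C f \<in> Ob C"
    and target_in_Ob: "f \<in> Mor C \<Longrightarrow> Target C f \<in> Ob C"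
    and ident_in_Hom: "x \<in> Ob C \<Longrightarrow> Ident C x \<in> Hom C x x"
    and comp_in_Hom: "f \<in> Hom C x y \<Longrightarrow> g \<in> Hom C y z \<Longrightarrow> Comp C g f \<in> Hom C x z"
    and comp_ident_right: "f \<in> Hom C x y \<Longrightarrow> Comp C f (Ident C x) = f"
    and comp_ident_left: "f \<in> Hom C x y \<Longrightarrow> Comp C (Ident C y) f = f"
    and comp_assoc: "f \<in> Hom C w x \<Longrightarrow> g \<in> Hom C x y \<Longrightarrow> h \<in> Hom C y z
      \<Longrightarrow> Comp C h (Comp C g f) = Comp C (Comp C h g) f"

(* Each step appends a pair of morphisms y \<rightarrow> z \<leftarrow> w to the zig-zag. *)
inductive zigzag :: "('o, 'm) cat \<Rightarrow> 'o \<Rightarrow> 'o \<Rightarrow> bool" for C :: "('o, 'm) cat" where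
  zigzag_refl: "x \<in> Ob C \<Longrightarrow> zigzag C x x"
| zigzag_step: "zigzag C x y \<Longrightarrow> f \<in> Hom C y z \<Longrightarrow> g \<in> Hom C w z \<Longrightarrow> zigzag C x w"

definition connected_cat :: "('o, 'm) cat \<Rightarrow> bool" where
  "connected_cat C \<longleftrightarrow> (\<forall>x \<in> Ob C. \<forall>y \<in> Ob C. zigzag C x y)"

definition S_set :: "('o, 'm) cat \<Rightarrow> 'o \<Rightarrow> 'm set" where
  "S_set C x = {f \<in> Mor C. Source C f = x}"

definition T_set :: "('o, 'm) cat \<Rightarrow> 'o \<Rightarrow> 'm set" where
  "T_set C x = {f \<in> Mor C. Target C f = x}"

record ('o1, 'm1, 'o2, 'm2) cat_map =
  on_Ob :: "'o1 \<Rightarrow> 'o2"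
  on_Mor :: "'m1 \<Rightarrow> 'm2"

locale cat_functor = dom: small_category E + cod: small_category B
  for E :: "('o1, 'm1) cat" and B :: "('o2, 'm2) cat" +
  fixes P :: "('o1, 'm1, 'o2, 'm2) cat_map"
  assumes on_Ob_in_Ob: "x \<in> Ob E \<Longrightarrow> on_Ob P x \<in> Ob B"
    and on_Mor_in_Hom: "f \<in> Hom E x y \<Longrightarrow> on_Mor P f \<in> Hom B (on_Ob P x) (on_Ob P y)"
    and on_Mor_ident: "x \<in> Ob E \<Longrightarrow> on_Mor P (Ident E x) = Ident B (on_Ob P x)"
    and on_Mor_comp: "f \<in> Hom E x y \<Longrightarrow> g \<in> Hom E y z
      \<Longrightarrow> on_Mor P (Comp E g f) = Comp B (on_Mor P g) (on_Mor P f)"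

locale covering = cat_functor E B P
  for E :: "('o1, 'm1) cat" and B :: "('o2, 'm2) cat"
    and P :: "('o1, 'm1, 'o2, 'm2) cat_map" +
  assumes base_connected: "connected_cat B"
    and bij_S: "x \<in> Ob E \<Longrightarrow> bij_betw (on_Mor P) (S_set E x) (S_set B (on_Ob P x))"
    and bij_T: "x \<in> Ob E \<Longrightarrow> bij_betw (on_Mor P) (T_set E x) (T_set B (on_Ob P x))"

definition fiber ::
  "('o1, 'm1) cat \<Rightarrow> ('o1, 'm1, 'o2, 'm2) cat_map \<Rightarrow> 'o2 \<Rightarrow> 'o1 set" where
  "fiber E P b = {x \<in> Ob E. on_Ob P x = b}"

(* A chain is recorded as the pair ([x_0, ..., x_n], [f_1, ..., f_n]), so that f_(i+1) is fs ! i.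
   For n = 0 it is ([x_0], []), i.e. an object. *)
definition nerve :: "nat \<Rightarrow> ('o, 'm) cat \<Rightarrow> ('o list \<times> 'm list) set" where
  "nerve n C = {(xs, fs). length xs = Suc n \<and> length fs = n \<and> set xs \<subseteq> Ob C \<and>
     (\<forall>i < n. fs ! i \<in> Hom C (xs ! i) (xs ! Suc i))}"

lemma nerve_0: "bij_betw (\<lambda>x. ([x], [])) (Ob C) (nerve 0 C)"
  by (auto simp: bij_betw_def inj_on_def nerve_def length_Suc_conv)

end

theory Submission
  imports Defs
begin

text \<open>
  A chain \<open>x\<^sub>0 \<rightarrow> \<dots> \<rightarrow> x\<^sub>n\<close> in \<open>E\<close> is determined by its initial object \<open>x\<^sub>0\<close> and its image in \<open>B\<close>,
  and every chain in \<open>B\<close> lifts to any object over its initial object: since \<open>P\<close> is bijective on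
  morphisms with a given source, the arrows are lifted one after the other, each at the target of
  the previous lift (\<open>unique_chain_lift\<close>). Hence \<open>nerve n E\<close> is, up to bijection, the
  disjoint union, over all chains in \<open>nerve n B\<close>, of the fibers over their initial objects.

  All these fibers can be identified with the one over \<open>b\<close>. Taking sources and
  taking targets map the lifts of an arrow \<open>y \<rightarrow> z\<close> of \<open>B\<close> to the fibers over \<open>y\<close> and \<open>z\<close>; both
  maps are bijections, by the two halves of the covering condition. Composing such bijections
  and their inverses along a zig-zag, which
  exists because \<open>B\<close> is connected, gives a bijection between any two fibers
  (\<open>fibers_equipotent\<close>). Sending a chain to its initial object, moved to the fiber over \<open>b\<close>,
  together with its image in \<open>B\<close> is then the required bijection.
\<close>

lemma nerve_0_iff: "(xs, fs) \<in> nerve 0 C \<longleftrightarrow> (\<exists>x \<in> Ob C. xs = [x] \<and> fs = [])"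
  by (auto simp: nerve_def length_Suc_conv)

lemma nerve_hd_in_Ob: "(xs, fs) \<in> nerve n C \<Longrightarrow> hd xs \<in> Ob C"
  by (cases xs) (auto simp: nerve_def)

text \<open>Splitting off the first arrow, rather than the last, fits lifting from the initial object:
  the lift of the first arrow supplies the initial object for the rest.\<close>

lemma nerve_Cons_iff:
  "(x # xs, f # fs) \<in> nerve (Suc n) C \<longleftrightarrow>
    x \<in> Ob C \<and> f \<in> Hom C x (hd xs) \<and> (xs, fs) \<in> nerve n C"
  by (cases xs) (auto simp: nerve_def All_less_Suc2 hd_conv_nth)

lemma nerve_SucE:
  assumes "(xs, fs) \<in> nerve (Suc n) C"
  obtains x xs' f fs' where "xs = x # xs'" "fs = f # fs'" "x \<in> Ob C"
    "f \<in> Hom C x (hd xs')" "(xs', fs') \<in> nerve n C"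
proof -
  from assms obtain x xs' f fs' where eq: "xs = x # xs'" "fs = f # fs'"
    by (auto simp: nerve_def length_Suc_conv)
  show thesis using that[OF eq] assms by (simp add: eq nerve_Cons_iff)
qed

context cat_functor
begin

definition chain_image :: "'o1 list \<times> 'm1 list \<Rightarrow> 'o2 list \<times> 'm2 list" where
  "chain_image = map_prod (map (on_Ob P)) (map (on_Mor P))"

lemma chain_image_in_nerve:
  assumes "c \<in> nerve n E"
  shows "chain_image c \<in> nerve n B"
proof -
  obtain xs fs where c: "c = (xs, fs)" by fastforce
  show ?thesis
    using assms by (auto simp: c chain_image_def nerve_def intro!: on_Ob_in_Ob on_Mor_in_Hom)
qed

lemma hd_chain_image:
  "c \<in> nerve n E \<Longrightarrow> hd (fst (chain_image c)) = on_Ob P (hd (fst c))"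
  by (cases c) (auto simp: chain_image_def nerve_def intro!: hd_map)

lemma source_on_Mor: "f \<in> Mor E \<Longrightarrow> Source B (on_Mor P f) = on_Ob P (Source E f)"
  and target_on_Mor: "f \<in> Mor E \<Longrightarrow> Target B (on_Mor P f) = on_Ob P (Target E f)"
  using on_Mor_in_Hom[of f] by (auto simp: Hom_def)

end

context covering
begin

lemma unique_arrow_lift_source:
  assumes "x \<in> Ob E" "g \<in> Mor B" "Source B g = on_Ob P x"
  shows "\<exists>!f. f \<in> Mor E \<and> Source E f = x \<and> on_Mor P f = g"
proof -
  have "g \<in> on_Mor P ` S_set E x"
    using assms bij_betw_imp_surj_on[OF bij_S] by (simp add: S_set_def)
  then have "\<exists>!f. f \<in> S_set E x \<and> on_Mor P f = g"
    using inj_onD[OF bij_betw_imp_inj_on[OF bij_S[OF assms(1)]]] by blast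
  then show ?thesis by (simp add: S_set_def conj_assoc)
qed

lemma unique_arrow_lift_target:
  assumes "x \<in> Ob E" "g \<in> Mor B" "Target B g = on_Ob P x"
  shows "\<exists>!f. f \<in> Mor E \<and> Target E f = x \<and> on_Mor P f = g"
proof -
  have "g \<in> on_Mor P ` T_set E x"
    using assms bij_betw_imp_surj_on[OF bij_T] by (simp add: T_set_def)
  then have "\<exists>!f. f \<in> T_set E x \<and> on_Mor P f = g"
    using inj_onD[OF bij_betw_imp_inj_on[OF bij_T[OF assms(1)]]] by blast
  then show ?thesis by (simp add: T_set_def conj_assoc)
qed

lemma bij_betw_source_lifts:
  assumes "g \<in> Mor B"
  shows "bij_betw (Source E) {f \<in> Mor E. on_Mor P f = g} (fiber E P (Source B g))"
proof (rule bij_betw_imageI)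
  show "inj_on (Source E) {f \<in> Mor E. on_Mor P f = g}"
  proof (rule inj_onI)
    fix f f' assume f: "f \<in> {f \<in> Mor E. on_Mor P f = g}" "f' \<in> {f \<in> Mor E. on_Mor P f = g}"
      and eq: "Source E f = Source E f'"
    have "Source E f \<in> Ob E" "Source B g = on_Ob P (Source E f)"
      using f(1) dom.source_in_Ob source_on_Mor by auto
    from unique_arrow_lift_source[OF this(1) assms this(2)] f eq show "f = f'" by auto
  qed
  show "Source E ` {f \<in> Mor E. on_Mor P f = g} = fiber E P (Source B g)"
  proof (intro equalityI subsetI)
    fix x assume "x \<in> fiber E P (Source B g)"
    with unique_arrow_lift_source[OF _ assms, of x]
    show "x \<in> Source E ` {f \<in> Mor E. on_Mor P f = g}" by (force simp: fiber_def)
  qed (auto simp: fiber_def source_on_Mor dom.source_in_Ob)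
qed

lemma bij_betw_target_lifts:
  assumes "g \<in> Mor B"
  shows "bij_betw (Target E) {f \<in> Mor E. on_Mor P f = g} (fiber E P (Target B g))"
proof (rule bij_betw_imageI)
  show "inj_on (Target E) {f \<in> Mor E. on_Mor P f = g}"
  proof (rule inj_onI)
    fix f f' assume f: "f \<in> {f \<in> Mor E. on_Mor P f = g}" "f' \<in> {f \<in> Mor E. on_Mor P f = g}"
      and eq: "Target E f = Target E f'"
    have "Target E f \<in> Ob E" "Target B g = on_Ob P (Target E f)"
      using f(1) dom.target_in_Ob target_on_Mor by auto
    from unique_arrow_lift_target[OF this(1) assms this(2)] f eq show "f = f'" by auto
  qed
  show "Target E ` {f \<in> Mor E. on_Mor P f = g} = fiber E P (Target B g)"
  proof (intro equalityI subsetI)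
    fix x assume "x \<in> fiber E P (Target B g)"
    with unique_arrow_lift_target[OF _ assms, of x]
    show "x \<in> Target E ` {f \<in> Mor E. on_Mor P f = g}" by (force simp: fiber_def)
  qed (auto simp: fiber_def target_on_Mor dom.target_in_Ob)
qed

text \<open>The bijection sends the source of each lift of \<open>g\<close> to the target of the same lift.\<close>

lemma arrow_fibers_equipotent:
  assumes "g \<in> Hom B y z"
  shows "\<exists>t. bij_betw t (fiber E P y) (fiber E P z)"
  using bij_betw_trans[OF bij_betw_inv_into[OF bij_betw_source_lifts] bij_betw_target_lifts]
    assms by (auto simp: Hom_def)

lemma zigzag_fibers_equipotent:
  "zigzag B y z \<Longrightarrow> \<exists>t. bij_betw t (fiber E P y) (fiber E P z)"
proof (induction rule: zigzag.induct)
  case (zigzag_refl y)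
  show ?case using bij_betw_id by blast
next
  case (zigzag_step y z f v g w)
  show ?case
    using zigzag_step.IH arrow_fibers_equipotent[OF zigzag_step.hyps(2)]
      arrow_fibers_equipotent[OF zigzag_step.hyps(3)]
    by (meson bij_betw_trans bij_betw_inv_into)
qed

lemma fibers_equipotent:
  "y \<in> Ob B \<Longrightarrow> z \<in> Ob B \<Longrightarrow> \<exists>t. bij_betw t (fiber E P y) (fiber E P z)"
  using zigzag_fibers_equipotent base_connected by (auto simp: connected_cat_def)

text \<open>The first arrow has exactly one lift at \<open>x\<close>, and the rest of the chain must then be lifted
  at the target of that lift, so both existence and uniqueness pass from shorter chains to
  longer ones.\<close>

lemma unique_chain_lift:
  assumes "x \<in> Ob E" "d \<in> nerve n B" "hd (fst d) = on_Ob P x"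
  shows "\<exists>!c. c \<in> nerve n E \<and> hd (fst c) = x \<and> chain_image c = d"
  using assms
proof (induction n arbitrary: x d)
  case 0
  from "0.prems"(2) obtain y where d: "d = ([y], [])" by (cases d) (auto simp: nerve_0_iff)
  show ?case
  proof (rule ex1I[of _ "([x], [])"])
    show "([x], []) \<in> nerve 0 E \<and> hd (fst ([x], [])) = x \<and> chain_image ([x], []) = d"
      using "0.prems"(1,3) by (simp add: nerve_0_iff chain_image_def d)
  next
    fix c assume "c \<in> nerve 0 E \<and> hd (fst c) = x \<and> chain_image c = d"
    then show "c = ([x], [])" by (cases c) (auto simp: nerve_0_iff)
  qed
next
  case (Suc n)
  obtain y ys g gs where d: "d = (y # ys, g # gs)" and g: "g \<in> Hom B y (hd ys)"
    and tail: "(ys, gs) \<in> nerve n B"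
    using Suc.prems(2) by (metis nerve_SucE surj_pair)
  have y: "y = on_Ob P x" using Suc.prems(3) d by simp
  have "\<exists>!f. f \<in> Mor E \<and> Source E f = x \<and> on_Mor P f = g"
    using unique_arrow_lift_source[OF Suc.prems(1)] g y by (simp add: Hom_def)
  then obtain f where f: "f \<in> Mor E" "Source E f = x" "on_Mor P f = g"
    and f_unique: "\<And>f'. f' \<in> Mor E \<Longrightarrow> Source E f' = x \<Longrightarrow> on_Mor P f' = g \<Longrightarrow> f' = f"
    by blast
  have x': "Target E f \<in> Ob E" using f dom.target_in_Ob by blast
  have "hd ys = on_Ob P (Target E f)" using target_on_Mor f g by (auto simp: Hom_def)
  from Suc.IH[OF x' tail] this
  have ex1: "\<exists>!c. c \<in> nerve n E \<and> hd (fst c) = Target E f \<and> chain_image c = (ys, gs)" by simp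
  then obtain xs fs where c: "(xs, fs) \<in> nerve n E" "hd xs = Target E f"
    "chain_image (xs, fs) = (ys, gs)" by auto
  show ?case
  proof (rule ex1I[of _ "(x # xs, f # fs)"])
    show "(x # xs, f # fs) \<in> nerve (Suc n) E \<and> hd (fst (x # xs, f # fs)) = x
        \<and> chain_image (x # xs, f # fs) = d"
      using c f Suc.prems(1) y by (auto simp: nerve_Cons_iff Hom_def chain_image_def d)
  next
    fix c' assume c': "c' \<in> nerve (Suc n) E \<and> hd (fst c') = x \<and> chain_image c' = d"
    then obtain xs' f' fs' where eq: "c' = (x # xs', f' # fs')"
      and f': "f' \<in> Hom E x (hd xs')" and tail': "(xs', fs') \<in> nerve n E"
      by (metis nerve_SucE surj_pair fst_conv list.sel(1))
    have img: "on_Mor P f' = g" "chain_image (xs', fs') = (ys, gs)"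
      using c' by (auto simp: eq d chain_image_def)
    have "f' = f" using f_unique f' img by (simp add: Hom_def)
    moreover have "(xs', fs') = (xs, fs)"
      using ex1 c tail' img f' \<open>f' = f\<close> by (auto simp: Hom_def)
    ultimately show "c' = (x # xs, f # fs)" by (simp add: eq)
  qed
qed

end

theorem proposition1p1:
  fixes E :: "('o1, 'm1) cat" and B :: "('o2, 'm2) cat"
    and P :: "('o1, 'm1, 'o2, 'm2) cat_map" and b :: 'o2 and n :: nat
  assumes "covering E B P"
    and "b \<in> Ob B"
  shows "\<exists>\<phi>. bij_betw \<phi> (nerve n E) (SIGMA x : fiber E P b. nerve n B)"
proof -
  interpret covering E B P by (fact assms(1))
  obtain t where t: "\<And>a. a \<in> Ob B \<Longrightarrow> bij_betw (t a) (fiber E P a) (fiber E P b)"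
    using fibers_equipotent[OF _ assms(2)] by metis
  define \<phi> where "\<phi> c = (t (on_Ob P (hd (fst c))) (hd (fst c)), chain_image c)" for c
  have hd_Ob: "hd (fst c) \<in> Ob E" if "c \<in> nerve n E" for c
    using that nerve_hd_in_Ob by (cases c) auto
  have "bij_betw \<phi> (nerve n E) (SIGMA x : fiber E P b. nerve n B)"
  proof (rule bij_betw_imageI)
    show "inj_on \<phi> (nerve n E)"
    proof (rule inj_onI)
      fix c c' assume c: "c \<in> nerve n E" and c': "c' \<in> nerve n E" and eq: "\<phi> c = \<phi> c'"
      let ?a = "on_Ob P (hd (fst c))"
      have img: "chain_image c = chain_image c'" using eq by (simp add: \<phi>_def)
      \<comment> \<open>Equal images begin at the same object, so the same transport \<open>t ?a\<close> was used.\<close>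
      then have a: "on_Ob P (hd (fst c')) = ?a"
        using hd_chain_image[OF c] hd_chain_image[OF c'] by simp
      have "inj_on (t ?a) (fiber E P ?a)"
        using t on_Ob_in_Ob[OF hd_Ob[OF c]] bij_betw_imp_inj_on by blast
      moreover have "t ?a (hd (fst c)) = t ?a (hd (fst c'))" using eq a by (simp add: \<phi>_def)
      ultimately have "hd (fst c) = hd (fst c')"
      proof (rule inj_onD)
        show "hd (fst c) \<in> fiber E P ?a" "hd (fst c') \<in> fiber E P ?a"
          using hd_Ob[OF c] hd_Ob[OF c'] a by (simp_all add: fiber_def)
      qed
      then show "c = c'"
        using unique_chain_lift[OF hd_Ob[OF c] chain_image_in_nerve[OF c] hd_chain_image[OF c]]
          c c' img by auto
    qed
    show "\<phi> ` nerve n E = (SIGMA x : fiber E P b. nerve n B)"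
    proof (intro equalityI subsetI)
      fix p assume "p \<in> \<phi> ` nerve n E"
      then obtain c where c: "c \<in> nerve n E" and p: "p = \<phi> c" by blast
      have "t (on_Ob P (hd (fst c))) (hd (fst c)) \<in> fiber E P b"
        using bij_betwE[OF t[OF on_Ob_in_Ob[OF hd_Ob[OF c]]]] hd_Ob[OF c]
        by (simp add: fiber_def)
      then show "p \<in> (SIGMA x : fiber E P b. nerve n B)"
        using chain_image_in_nerve[OF c] by (simp add: p \<phi>_def)
    next
      fix p assume "p \<in> (SIGMA x : fiber E P b. nerve n B)"
      then obtain z d where p: "p = (z, d)" and z: "z \<in> fiber E P b" and d: "d \<in> nerve n B"
        by blast
      let ?a = "hd (fst d)"
      have "?a \<in> Ob B" using d nerve_hd_in_Ob by (cases d) auto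
      then obtain x where x: "x \<in> fiber E P ?a" "t ?a x = z"
        using t z by (metis bij_betw_imp_surj_on imageE)
      then obtain c where "c \<in> nerve n E" "hd (fst c) = x" "chain_image c = d"
        using unique_chain_lift[OF _ d, of x] by (auto simp: fiber_def)
      then have "\<phi> c = p" using x by (simp add: \<phi>_def p fiber_def)
      then show "p \<in> \<phi> ` nerve n E" using \<open>c \<in> nerve n E\<close> by blast
    qed
  qed
  then show ?thesis by blast
qed

end
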